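(* There exist infinitely many pairwise nonisomorphic inverse monoids $S$ such that $S$ is finitely presented (as an inverse monoid), $S$ is 3-generated (as an inverse monoid), and: (i) every $\mathcal{R}$-class of $S$ is finite; (ii) $\mu_S(s)$ is infinite for some $s \in S$.
   Context: For an inverse semigroup $S$, $E(S)$ denotes its semilattice of idempotents and $\leq$ its natural partial order: $a \leq b$ if and only if $a = eb$ for some $e \in E(S)$. For $s \in S$, let $\lambda_S(s) = \{ t \in S \mid t \leq s\}$, and let $\mu_S(s)$ denote the set of maximal elements (with respect to $\leq$) of $\lambda_S(s) \cap E(S)$. $\mathcal{R}$ is Green's relation; in an inverse semigroup, $s \mathrel{\mathcal{R}} t$ if and only if $ss^{-1} = tt^{-1}$. An inverse monoid is 3-generated if it is generated, as an inverse monoid (i.e. using products, inverses and the identity), by a set of three elements. For an alphabet $A$, let $A^{-1}$ be a set of formal inverses of $A$ and $\widetilde{A} = A \cup A^{-1}$, and extend $^{-1}$ to an involution on the free monoid $\widetilde{A}^*$ in the usual way. An inverse monoid presentation is a formal expression $\langle A \mid R\rangle$ with $R \subseteq \widetilde{A}^* \times \widetilde{A}^*$; the inverse monoid it defines is $\widetilde{A}^*/\tau$, where $\tau$ is the congruence on $\widetilde{A}^*$ generated by $R$ together with all pairs $(ww^{-1}w, w)$ and $(uu^{-1}vv^{-1}, vv^{-1}uu^{-1})$ for $u,v,w \in \widetilde{A}^*$. An inverse monoid is finitely presented if it is defined by some inverse monoid presentation $\langle A \mid R\rangle$ with $A$ and $R$ finite. *)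

theory Defs
  imports "HOL-Algebra.Coset"
begin

locale inverse_monoid = monoid S for S (structure) +
  assumes ex1_inverse:
    "x \<in> carrier S \<Longrightarrow> \<exists>!y. y \<in> carrier S \<and> x \<otimes> y \<otimes> x = x \<and> y \<otimes> x \<otimes> y = y"

text \<open>The generalized (von Neumann) inverse; the library's \<open>m_inv\<close> is the inverse of a unit.\<close>

definition ginv :: "('a, 'b) monoid_scheme \<Rightarrow> 'a \<Rightarrow> 'a" where
  "ginv S x = (THE y. y \<in> carrier S \<and> x \<otimes>\<^bsub>S\<^esub> y \<otimes>\<^bsub>S\<^esub> x = x \<and> y \<otimes>\<^bsub>S\<^esub> x \<otimes>\<^bsub>S\<^esub> y = y)"

definition idempotents :: "('a, 'b) monoid_scheme \<Rightarrow> 'a set" where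
  "idempotents S = {e \<in> carrier S. e \<otimes>\<^bsub>S\<^esub> e = e}"

definition nat_le :: "('a, 'b) monoid_scheme \<Rightarrow> 'a \<Rightarrow> 'a \<Rightarrow> bool" where
  "nat_le S a b \<longleftrightarrow> (\<exists>e \<in> idempotents S. a = e \<otimes>\<^bsub>S\<^esub> b)"

definition lower_set :: "('a, 'b) monoid_scheme \<Rightarrow> 'a \<Rightarrow> 'a set" where
  "lower_set S s = {t \<in> carrier S. nat_le S t s}"

definition max_idem_below :: "('a, 'b) monoid_scheme \<Rightarrow> 'a \<Rightarrow> 'a set" where
  "max_idem_below S s =
     {e \<in> lower_set S s \<inter> idempotents S.
        \<forall>f \<in> lower_set S s \<inter> idempotents S. nat_le S e f \<longrightarrow> f = e}"

text \<open>Equality of principal right ideals; as \<open>S\<close> has an identity, \<open>S\<^sup>1 = S\<close>.\<close>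

definition green_R :: "('a, 'b) monoid_scheme \<Rightarrow> 'a rel" where
  "green_R S = {(s, t). s \<in> carrier S \<and> t \<in> carrier S \<and>
     s <#\<^bsub>S\<^esub> carrier S = t <#\<^bsub>S\<^esub> carrier S}"

inductive_set inv_submonoid_gen :: "('a, 'b) monoid_scheme \<Rightarrow> 'a set \<Rightarrow> 'a set"
  for S and X where
  one: "\<one>\<^bsub>S\<^esub> \<in> inv_submonoid_gen S X"
| incl: "x \<in> X \<Longrightarrow> x \<in> inv_submonoid_gen S X"
| ginv: "x \<in> inv_submonoid_gen S X \<Longrightarrow> ginv S x \<in> inv_submonoid_gen S X"
| mult: "x \<in> inv_submonoid_gen S X \<Longrightarrow> y \<in> inv_submonoid_gen S X \<Longrightarrow>
    x \<otimes>\<^bsub>S\<^esub> y \<in> inv_submonoid_gen S X"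

definition n_generated :: "nat \<Rightarrow> ('a, 'b) monoid_scheme \<Rightarrow> bool" where
  "n_generated n S \<longleftrightarrow>
     (\<exists>X. X \<subseteq> carrier S \<and> finite X \<and> card X = n \<and> inv_submonoid_gen S X = carrier S)"

text \<open>The letter \<open>(a, False)\<close> stands for \<open>a\<close> and \<open>(a, True)\<close> for its formal inverse.\<close>

type_synonym 'a word = "('a \<times> bool) list"

definition words :: "'a set \<Rightarrow> 'a word set" where
  "words A = lists (A \<times> UNIV)"

definition word_inv :: "'a word \<Rightarrow> 'a word" where
  "word_inv w = rev (map (\<lambda>(a, b). (a, \<not> b)) w)"

inductive_set pres_cong :: "'a set \<Rightarrow> 'a word rel \<Rightarrow> 'a word rel"
  for A and R where
  rel: "(u, v) \<in> R \<Longrightarrow> (u, v) \<in> pres_cong A R"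
| regular: "w \<in> words A \<Longrightarrow> (w @ word_inv w @ w, w) \<in> pres_cong A R"
| idem_comm: "u \<in> words A \<Longrightarrow> v \<in> words A \<Longrightarrow>
    (u @ word_inv u @ v @ word_inv v, v @ word_inv v @ u @ word_inv u) \<in> pres_cong A R"
| refl: "w \<in> words A \<Longrightarrow> (w, w) \<in> pres_cong A R"
| sym: "(u, v) \<in> pres_cong A R \<Longrightarrow> (v, u) \<in> pres_cong A R"
| trans: "(u, v) \<in> pres_cong A R \<Longrightarrow> (v, w) \<in> pres_cong A R \<Longrightarrow> (u, w) \<in> pres_cong A R"
| mult: "(u, v) \<in> pres_cong A R \<Longrightarrow> (x, y) \<in> pres_cong A R \<Longrightarrow>
    (u @ x, v @ y) \<in> pres_cong A R"

definition pres_monoid :: "'a set \<Rightarrow> 'a word rel \<Rightarrow> 'a word set monoid" where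
  "pres_monoid A R =
     \<lparr>carrier = words A // pres_cong A R,
      mult = (\<lambda>X Y. \<Union>x\<in>X. \<Union>y\<in>Y. pres_cong A R `` {x @ y}),
      one = pres_cong A R `` {[]}\<rparr>"

text \<open>Since the alphabet is finite, its letters may be taken to be natural numbers.\<close>

definition finitely_presented :: "('a, 'b) monoid_scheme \<Rightarrow> bool" where
  "finitely_presented S \<longleftrightarrow>
     (\<exists>(A :: nat set) R. finite A \<and> finite R \<and> R \<subseteq> words A \<times> words A \<and>
        S \<cong> pres_monoid A R)"

end

theory Submission
  imports Defs
begin

text \<open>
  For \<open>k \<ge> 2\<close> let \<open>S\<^sub>k\<close> be generated by \<open>a\<close>, \<open>b\<close>, \<open>c\<close>, where \<open>c\<close> is a central unit with
  \<open>c\<^sup>k = 1\<close>, \<open>b\<close> is idempotent and \<open>b c = b\<close>. A word is a walk on \<open>\<int>\<close> (\<open>a\<close> moves right, \<open>b\<close> marks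
  the current point, \<open>c\<close> is counted modulo \<open>k\<close>); the set of visited points, the set of marks and
  the endpoint are invariants of the element, and so is the count as long as there are no marks.
  Conversely every word \<open>w\<close> lies below \<open>a\<^sup>p c\<^sup>i\<close>, with \<open>p\<close> its endpoint and \<open>i\<close> its count. Hence words
  with \<open>p = 0\<close> and \<open>k | i\<close> are idempotent, so an element of an \<open>\<R>\<close>-class is determined by \<open>p\<close>, which
  lies in the finite set of visited points common to the class, and \<open>i mod k\<close>. An idempotent
  lies below \<open>c\<close> only if it has a mark, so the \<open>a\<^sup>n b a\<^sup>-\<^sup>n\<close> are maximal ones. Finally, the
  units are the powers of \<open>c\<close>, so \<open>k\<close> is an isomorphism invariant.
\<close>

section \<open>Inverse monoids\<close>

text \<open>Only these two pairs of idempotents have to commute: the first gives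
  \<open>y = z x y\<close>, the second \<open>z = z x y\<close>. The setting is a bare monoid, so
  that the lemma can help to show that a monoid is inverse.\<close>

lemma (in monoid) inverse_unique_if_commute:
  assumes carr [simp]: "x \<in> carrier G" "y \<in> carrier G" "z \<in> carrier G"
    and y: "x \<otimes> y \<otimes> x = x" "y \<otimes> x \<otimes> y = y"
    and z: "x \<otimes> z \<otimes> x = x" "z \<otimes> x \<otimes> z = z"
    and comm: "(y \<otimes> x) \<otimes> (z \<otimes> x) = (z \<otimes> x) \<otimes> (y \<otimes> x)"
      "(x \<otimes> y) \<otimes> (x \<otimes> z) = (x \<otimes> z) \<otimes> (x \<otimes> y)"
  shows "y = z"
proof -
  have "y = y \<otimes> (x \<otimes> z \<otimes> x) \<otimes> y" using y z by simp
  also have "\<dots> = (y \<otimes> x) \<otimes> (z \<otimes> x) \<otimes> y" by (simp add: m_assoc)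
  also have "\<dots> = (z \<otimes> x) \<otimes> (y \<otimes> x \<otimes> y)" by (simp add: comm m_assoc)
  finally have 1: "y = z \<otimes> x \<otimes> y" using y by simp
  have "z = z \<otimes> (x \<otimes> y \<otimes> x) \<otimes> z" using y z by simp
  also have "\<dots> = z \<otimes> ((x \<otimes> y) \<otimes> (x \<otimes> z))" by (simp add: m_assoc)
  also have "\<dots> = (z \<otimes> x \<otimes> z) \<otimes> (x \<otimes> y)" by (simp add: comm m_assoc)
  finally have "z = z \<otimes> x \<otimes> y" using z by (simp add: m_assoc)
  with 1 show ?thesis by simp
qed

lemma (in monoid) inverse_monoidI:
  assumes inv: "\<And>x. x \<in> carrier G \<Longrightarrow> \<exists>y \<in> carrier G. x \<otimes> y \<otimes> x = x \<and> y \<otimes> x \<otimes> y = y"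
    and comm: "\<And>e f. e \<in> idempotents G \<Longrightarrow> f \<in> idempotents G \<Longrightarrow> e \<otimes> f = f \<otimes> e"
  shows "inverse_monoid G"
proof
  fix x assume x: "x \<in> carrier G"
  have idem: "x \<otimes> y \<in> idempotents G" "y \<otimes> x \<in> idempotents G"
    if "y \<in> carrier G" "x \<otimes> y \<otimes> x = x" for y
    using that x unfolding idempotents_def by (simp_all add: m_assoc) (simp add: m_assoc[symmetric])
  show "\<exists>!y. y \<in> carrier G \<and> x \<otimes> y \<otimes> x = x \<and> y \<otimes> x \<otimes> y = y"
  proof (rule ex_ex1I)
    show "\<exists>y. y \<in> carrier G \<and> x \<otimes> y \<otimes> x = x \<and> y \<otimes> x \<otimes> y = y" using inv[OF x] by blast
  next
    fix y z
    assume y: "y \<in> carrier G \<and> x \<otimes> y \<otimes> x = x \<and> y \<otimes> x \<otimes> y = y"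
      and z: "z \<in> carrier G \<and> x \<otimes> z \<otimes> x = x \<and> z \<otimes> x \<otimes> z = z"
    show "y = z"
      by (rule inverse_unique_if_commute[of x]) (use x y z in \<open>auto intro!: comm idem\<close>)
  qed
qed

lemma (in monoid) green_R_factor:
  assumes "(s, t) \<in> green_R G"
  shows "s \<in> carrier G" "t \<in> carrier G"
    and "\<exists>z \<in> carrier G. t = s \<otimes> z" "\<exists>z \<in> carrier G. s = t \<otimes> z"
proof -
  show st: "s \<in> carrier G" "t \<in> carrier G" using assms by (auto simp: green_R_def)
  have "t \<in> t <# carrier G" "s \<in> s <# carrier G"
    unfolding l_coset_def using st by (auto intro!: bexI[of _ "\<one>"])
  then have "t \<in> s <# carrier G" "s \<in> t <# carrier G"
    using assms by (auto simp: green_R_def)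
  then show "\<exists>z \<in> carrier G. t = s \<otimes> z" "\<exists>z \<in> carrier G. s = t \<otimes> z"
    by (auto simp: l_coset_def)
qed

context inverse_monoid
begin

lemma inverse_unique:
  assumes "x \<in> carrier S"
    and "y \<in> carrier S" "x \<otimes> y \<otimes> x = x" "y \<otimes> x \<otimes> y = y"
    and "z \<in> carrier S" "x \<otimes> z \<otimes> x = x" "z \<otimes> x \<otimes> z = z"
  shows "y = z"
  using ex1_inverse[of x] assms by blast

lemma ginv_eqI:
  assumes "x \<in> carrier S" "y \<in> carrier S" "x \<otimes> y \<otimes> x = x" "y \<otimes> x \<otimes> y = y"
  shows "ginv S x = y"
  unfolding ginv_def using assms inverse_unique by blast

lemma ginv:
  assumes "x \<in> carrier S"
  shows ginv_closed: "ginv S x \<in> carrier S"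
    and mult_ginv_mult: "x \<otimes> ginv S x \<otimes> x = x"
    and ginv_mult_ginv: "ginv S x \<otimes> x \<otimes> ginv S x = ginv S x"
  using theI'[OF ex1_inverse[OF assms]] unfolding ginv_def by auto

lemma idempotent_closed: "e \<in> idempotents S \<Longrightarrow> e \<in> carrier S"
  by (simp add: idempotents_def)

lemma idempotent_idem: "e \<in> idempotents S \<Longrightarrow> e \<otimes> e = e"
  by (simp add: idempotents_def)

lemma idempotent_left_idem:
  "e \<in> idempotents S \<Longrightarrow> x \<in> carrier S \<Longrightarrow> e \<otimes> (e \<otimes> x) = e \<otimes> x"
  by (simp add: idempotents_def m_assoc[symmetric])

text \<open>Let \<open>x\<close> be the inverse of \<open>e f\<close>. Then \<open>f x e\<close> is
  an inverse of \<open>e f\<close> too, so \<open>x = f x e\<close>, which is idempotent. An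
  idempotent is its own inverse, and \<open>e f\<close> is also an inverse of \<open>x\<close>;
  hence \<open>e f = x\<close>.\<close>

lemma idempotent_mult:
  assumes e: "e \<in> idempotents S" and f: "f \<in> idempotents S"
  shows "e \<otimes> f \<in> idempotents S"
proof -
  note [simp] = idempotent_closed[OF e] idempotent_closed[OF f]
    idempotent_idem[OF e] idempotent_idem[OF f] idempotent_left_idem[OF e] idempotent_left_idem[OF f]
  define x where "x = ginv S (e \<otimes> f)"
  have x [simp]: "x \<in> carrier S" unfolding x_def by (simp add: ginv_closed)
  have 1: "e \<otimes> (f \<otimes> (x \<otimes> (e \<otimes> f))) = e \<otimes> f"
    using mult_ginv_mult[of "e \<otimes> f"] by (simp add: x_def[symmetric] m_assoc)
  have 2: "x \<otimes> (e \<otimes> (f \<otimes> x)) = x"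
    using ginv_mult_ginv[of "e \<otimes> f"] by (simp add: x_def[symmetric] m_assoc)
  \<comment> \<open>This is fact 2 with a trailing factor, for rewriting inside right-nested
    products.\<close>
  have 3: "x \<otimes> (e \<otimes> (f \<otimes> (x \<otimes> y))) = x \<otimes> y" if "y \<in> carrier S" for y
    using 2 that by (metis f e idempotent_closed m_assoc m_closed x)
  have "ginv S (e \<otimes> f) = f \<otimes> (x \<otimes> e)"
    by (rule ginv_eqI) (simp_all add: m_assoc 1 3)
  then have fxe: "x = f \<otimes> (x \<otimes> e)" by (simp add: x_def)
  have "x \<otimes> x = (f \<otimes> (x \<otimes> e)) \<otimes> (f \<otimes> (x \<otimes> e))" using fxe by simp
  also have "\<dots> = f \<otimes> (x \<otimes> e)" by (simp add: m_assoc 3)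
  finally have xx: "x \<otimes> x = x" using fxe by simp
  have "e \<otimes> f = x"
    by (rule inverse_unique[of x]) (simp_all add: xx m_assoc 1 2)
  then show ?thesis using xx by (simp add: idempotents_def)
qed

text \<open>As \<open>e f\<close> and \<open>f e\<close> are idempotent, both are inverses of
  \<open>e f\<close>.\<close>

lemma idempotents_commute:
  assumes e: "e \<in> idempotents S" and f: "f \<in> idempotents S"
  shows "e \<otimes> f = f \<otimes> e"
proof -
  note [simp] = idempotent_closed[OF e] idempotent_closed[OF f]
    idempotent_idem[OF e] idempotent_idem[OF f] idempotent_left_idem[OF e] idempotent_left_idem[OF f]
  have ef: "e \<otimes> (f \<otimes> (e \<otimes> f)) = e \<otimes> f" and fe: "f \<otimes> (e \<otimes> (f \<otimes> e)) = f \<otimes> e"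
    using idempotent_idem[OF idempotent_mult[OF e f]] idempotent_idem[OF idempotent_mult[OF f e]]
    by (simp_all add: m_assoc)
  show ?thesis
    by (rule inverse_unique[of "e \<otimes> f"]) (simp_all add: m_assoc ef fe)
qed

lemma one_idempotent: "\<one> \<in> idempotents S"
  by (simp add: idempotents_def)

text \<open>The witness is the conjugate of \<open>e\<close> by \<open>x\<close>. Moving idempotents
  to the left in this way makes the one-sided definition of the order usable in products.\<close>

lemma conjugate_idempotent:
  assumes e: "e \<in> idempotents S" and x: "x \<in> carrier S"
  obtains f where "f \<in> idempotents S" "x \<otimes> e = f \<otimes> x"
proof
  define y where "y = ginv S x"
  have y: "y \<in> carrier S" "x \<otimes> y \<otimes> x = x" "y \<otimes> x \<otimes> y = y"
    using ginv_closed mult_ginv_mult ginv_mult_ginv x unfolding y_def by auto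
  have ec [simp]: "e \<in> carrier S" using e by (rule idempotent_closed)
  have yx: "y \<otimes> x \<in> idempotents S"
    using x y by (simp add: idempotents_def m_assoc[symmetric])
  have comm: "e \<otimes> (y \<otimes> x) = (y \<otimes> x) \<otimes> e"
    by (rule idempotents_commute[OF e yx])
  have "x \<otimes> e \<otimes> y \<otimes> x = x \<otimes> (e \<otimes> (y \<otimes> x))" using x y by (simp add: m_assoc)
  also have "\<dots> = x \<otimes> y \<otimes> x \<otimes> e" unfolding comm using x y(1) by (simp add: m_assoc)
  finally have eq: "x \<otimes> e \<otimes> y \<otimes> x = x \<otimes> e" using y by simp
  then show "x \<otimes> e = (x \<otimes> e \<otimes> y) \<otimes> x" by simp
  have "(x \<otimes> e \<otimes> y) \<otimes> (x \<otimes> e \<otimes> y) = (x \<otimes> e \<otimes> y \<otimes> x) \<otimes> e \<otimes> y"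
    using x y by (simp add: m_assoc)
  also have "\<dots> = x \<otimes> (e \<otimes> e) \<otimes> y" unfolding eq using x y by (simp add: m_assoc)
  finally show "x \<otimes> e \<otimes> y \<in> idempotents S"
    using x y idempotent_idem[OF e] by (simp add: idempotents_def)
qed

section \<open>The natural partial order\<close>

lemma nat_le_refl: "x \<in> carrier S \<Longrightarrow> nat_le S x x"
  unfolding nat_le_def using one_idempotent by force

lemma nat_le_trans:
  assumes "nat_le S x y" "nat_le S y z" "z \<in> carrier S"
  shows "nat_le S x z"
proof -
  obtain e f where ef: "e \<in> idempotents S" "f \<in> idempotents S" "x = e \<otimes> y" "y = f \<otimes> z"
    using assms unfolding nat_le_def by blast
  then have "x = (e \<otimes> f) \<otimes> z" using assms(3) by (simp add: m_assoc idempotent_closed)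
  then show ?thesis using idempotent_mult ef unfolding nat_le_def by blast
qed

lemma nat_le_antisym:
  assumes "nat_le S x y" "nat_le S y x" "x \<in> carrier S" "y \<in> carrier S"
  shows "x = y"
proof -
  obtain e f where ef: "e \<in> idempotents S" "f \<in> idempotents S" and x: "x = e \<otimes> y" and y: "y = f \<otimes> x"
    using assms unfolding nat_le_def by blast
  note [simp] = assms(3,4) ef[THEN idempotent_closed]
  have fy: "f \<otimes> y = y"
    using idempotent_left_idem[OF ef(2) assms(3)] y by simp
  have "x = e \<otimes> (f \<otimes> y)" using x fy by simp
  also have "\<dots> = f \<otimes> (e \<otimes> y)"
    using idempotents_commute[OF ef] by (simp add: m_assoc[symmetric])
  also have "\<dots> = y" using x y by simp
  finally show ?thesis .
qed

text \<open>The idempotent between the two factors passes to the left of \<open>y\<close> by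
  conjugation and merges with the one already there.\<close>

lemma nat_le_mult:
  assumes "nat_le S x y" "nat_le S x' y'" and y: "y \<in> carrier S" and y': "y' \<in> carrier S"
  shows "nat_le S (x \<otimes> x') (y \<otimes> y')"
proof -
  obtain e f where ef: "e \<in> idempotents S" "f \<in> idempotents S" and x: "x = e \<otimes> y" "x' = f \<otimes> y'"
    using assms(1,2) unfolding nat_le_def by blast
  obtain g where g: "g \<in> idempotents S" "y \<otimes> f = g \<otimes> y"
    using conjugate_idempotent[OF ef(2) y] .
  note [simp] = y y' ef[THEN idempotent_closed] g(1)[THEN idempotent_closed]
  have "x \<otimes> x' = e \<otimes> (y \<otimes> f) \<otimes> y'" by (simp add: x m_assoc)
  also have "\<dots> = (e \<otimes> g) \<otimes> (y \<otimes> y')" by (simp add: g(2) m_assoc)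
  finally show ?thesis
    using idempotent_mult[OF ef(1) g(1)] unfolding nat_le_def by blast
qed

lemma nat_le_one_iff: "nat_le S x \<one> \<longleftrightarrow> x \<in> idempotents S"
  unfolding nat_le_def by (auto simp: idempotents_def)

text \<open>Write \<open>s e = f s\<close>. Then \<open>s = f s z\<close> is fixed by
  \<open>f\<close>, so \<open>s e = f s = s\<close>.\<close>

lemma R_related_mult_idempotent:
  assumes s: "s \<in> carrier S" and e: "e \<in> idempotents S" and z: "z \<in> carrier S"
    and eq: "s = s \<otimes> e \<otimes> z"
  shows "s \<otimes> e = s"
proof -
  obtain f where f: "f \<in> idempotents S" "s \<otimes> e = f \<otimes> s"
    using conjugate_idempotent[OF e s] .
  note [simp] = f(1)[THEN idempotent_closed] s z
  have "f \<otimes> s = f \<otimes> (f \<otimes> s \<otimes> z)" using eq f(2) by simp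
  also have "\<dots> = f \<otimes> s \<otimes> z" using idempotent_left_idem[OF f(1)] by (simp add: m_assoc)
  finally show ?thesis using f(2) eq by simp
qed

end

section \<open>Presented inverse monoids\<close>

lemma words_append [simp]: "u @ v \<in> words A \<longleftrightarrow> u \<in> words A \<and> v \<in> words A"
  by (auto simp: words_def)

lemma words_Nil [simp]: "[] \<in> words A"
  by (simp add: words_def)

lemma words_Cons [simp]: "x # w \<in> words A \<longleftrightarrow> fst x \<in> A \<and> w \<in> words A"
  by (cases x) (auto simp: words_def)

lemma words_replicate [simp]: "fst x \<in> A \<Longrightarrow> replicate n x \<in> words A"
  by (induction n) auto

lemma word_inv_Nil [simp]: "word_inv [] = []"
  by (simp add: word_inv_def)

lemma word_inv_Cons [simp]: "word_inv (x # w) = word_inv w @ [(fst x, \<not> snd x)]"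
  by (cases x) (simp add: word_inv_def)

lemma word_inv_append [simp]: "word_inv (u @ v) = word_inv v @ word_inv u"
  by (simp add: word_inv_def)

lemma word_inv_words [simp]: "word_inv w \<in> words A \<longleftrightarrow> w \<in> words A"
  by (induction w) auto

lemma word_inv_word_inv [simp]: "word_inv (word_inv w) = w"
  by (induction w) auto

locale presentation =
  fixes A :: "'a set" and R :: "'a word rel"
  assumes rel_words: "R \<subseteq> words A \<times> words A"
begin

abbreviation cls :: "'a word \<Rightarrow> 'a word set" where
  "cls w \<equiv> pres_cong A R `` {w}"

abbreviation PM :: "'a word set monoid" where
  "PM \<equiv> pres_monoid A R"

lemma pres_cong_words: "(u, v) \<in> pres_cong A R \<Longrightarrow> u \<in> words A \<and> v \<in> words A"
  by (induction rule: pres_cong.induct) (use rel_words in auto)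

lemma equiv_pres_cong: "equiv (words A) (pres_cong A R)"
  by (intro equivI refl_onI symI transI)
    (auto dest: pres_cong_words intro: pres_cong.refl pres_cong.sym pres_cong.trans)

lemma cls_eq_iff: "u \<in> words A \<Longrightarrow> v \<in> words A \<Longrightarrow> cls u = cls v \<longleftrightarrow> (u, v) \<in> pres_cong A R"
  using eq_equiv_class_iff[OF equiv_pres_cong] by blast

lemma cls_eqI: "(u, v) \<in> pres_cong A R \<Longrightarrow> cls u = cls v"
  using cls_eq_iff pres_cong_words by blast

lemma carrier_PM: "carrier PM = cls ` words A"
  by (auto simp: pres_monoid_def quotient_def)

lemma cls_closed [simp]: "w \<in> words A \<Longrightarrow> cls w \<in> carrier PM"
  by (simp add: carrier_PM)

lemma PM_cases:
  assumes "x \<in> carrier PM"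
  obtains w where "w \<in> words A" "x = cls w"
  using assms by (auto simp: carrier_PM)

lemma one_PM: "\<one>\<^bsub>PM\<^esub> = cls []"
  by (simp add: pres_monoid_def)

lemma mult_PM:
  assumes u: "u \<in> words A" and v: "v \<in> words A"
  shows "cls u \<otimes>\<^bsub>PM\<^esub> cls v = cls (u @ v)"
proof -
  have "cls (x @ y) = cls (u @ v)" if "x \<in> cls u" "y \<in> cls v" for x y
    using that by (intro cls_eqI pres_cong.mult pres_cong.sym[of u] pres_cong.sym[of v]) auto
  \<comment> \<open>The family is constant, and both index sets are nonempty, so the union collapses
    to one class.\<close>
  then have "(\<Union>x\<in>cls u. \<Union>y\<in>cls v. cls (x @ y)) = (\<Union>x\<in>cls u. \<Union>y\<in>cls v. cls (u @ v))"
    by (intro SUP_cong HOL.refl)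
  moreover have "u \<in> cls u" "v \<in> cls v" using u v pres_cong.refl by auto
  ultimately show ?thesis unfolding pres_monoid_def by (simp only: monoid.simps UN_constant) auto
qed

lemma monoid_PM: "monoid PM"
  by (rule monoidI) (auto elim!: PM_cases simp: mult_PM one_PM)

lemma cls_word_inv:
  assumes "w \<in> words A"
  shows "cls w \<otimes>\<^bsub>PM\<^esub> cls (word_inv w) \<otimes>\<^bsub>PM\<^esub> cls w = cls w"
  using assms by (simp add: mult_PM cls_eqI pres_cong.regular)

lemma cls_range_idempotents_commute:
  assumes "u \<in> words A" "v \<in> words A"
  shows "(cls u \<otimes>\<^bsub>PM\<^esub> cls (word_inv u)) \<otimes>\<^bsub>PM\<^esub> (cls v \<otimes>\<^bsub>PM\<^esub> cls (word_inv v)) =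
    (cls v \<otimes>\<^bsub>PM\<^esub> cls (word_inv v)) \<otimes>\<^bsub>PM\<^esub> (cls u \<otimes>\<^bsub>PM\<^esub> cls (word_inv u))"
  using assms by (simp add: mult_PM cls_eqI pres_cong.idem_comm)

text \<open>The congruence has no rule for formal inversion. Both formal inverses are inverses of
  the same class, and the idempotents in question commute by \<open>idem_comm\<close>, which forces
  uniqueness.\<close>

lemma cls_word_inv_cong:
  assumes u: "u \<in> words A" and v: "v \<in> words A" and eq: "cls u = cls v"
  shows "cls (word_inv u) = cls (word_inv v)"
proof (rule monoid.inverse_unique_if_commute[OF monoid_PM, of "cls u"])
  show "cls u \<otimes>\<^bsub>PM\<^esub> cls (word_inv v) \<otimes>\<^bsub>PM\<^esub> cls u = cls u"
    "cls (word_inv v) \<otimes>\<^bsub>PM\<^esub> cls u \<otimes>\<^bsub>PM\<^esub> cls (word_inv v) = cls (word_inv v)"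
    unfolding eq using v cls_word_inv[of v] cls_word_inv[of "word_inv v"] by auto
  show "cls (word_inv u) \<otimes>\<^bsub>PM\<^esub> cls u \<otimes>\<^bsub>PM\<^esub> (cls (word_inv v) \<otimes>\<^bsub>PM\<^esub> cls u) =
    cls (word_inv v) \<otimes>\<^bsub>PM\<^esub> cls u \<otimes>\<^bsub>PM\<^esub> (cls (word_inv u) \<otimes>\<^bsub>PM\<^esub> cls u)"
    using cls_range_idempotents_commute[of "word_inv u" "word_inv v"] u v eq by simp
  show "cls u \<otimes>\<^bsub>PM\<^esub> cls (word_inv u) \<otimes>\<^bsub>PM\<^esub> (cls u \<otimes>\<^bsub>PM\<^esub> cls (word_inv v)) =
    cls u \<otimes>\<^bsub>PM\<^esub> cls (word_inv v) \<otimes>\<^bsub>PM\<^esub> (cls u \<otimes>\<^bsub>PM\<^esub> cls (word_inv u))"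
    using cls_range_idempotents_commute[of u v] u v eq by simp
qed (use u v cls_word_inv[of u] cls_word_inv[of "word_inv u"] in auto)

text \<open>The rule \<open>idem_comm\<close> covers only idempotents of the form
  \<open>u u^-1\<close>, so every idempotent is brought to this form. With \<open>r\<close> the
  inverse of \<open>q\<close>, also \<open>r\<close> is idempotent, and
  \<open>r = (r q)(q r) = (q r)(r q) = q r q = q\<close>.\<close>

lemma idempotent_PM:
  assumes q: "q \<in> words A" and idem: "cls (q @ q) = cls q"
  shows "cls q = cls q \<otimes>\<^bsub>PM\<^esub> cls (word_inv q)"
proof -
  let ?r = "word_inv q"
  interpret monoid PM by (rule monoid_PM)
  note [simp] = q
  have qq: "cls q \<otimes>\<^bsub>PM\<^esub> cls q = cls q" using idem by (simp add: mult_PM)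
  have rr: "cls ?r \<otimes>\<^bsub>PM\<^esub> cls ?r = cls ?r"
    using cls_word_inv_cong[of "q @ q" q] idem by (simp add: mult_PM)
  have "cls ?r = cls ?r \<otimes>\<^bsub>PM\<^esub> (cls q \<otimes>\<^bsub>PM\<^esub> cls q) \<otimes>\<^bsub>PM\<^esub> cls ?r"
    unfolding qq using cls_word_inv[of ?r] by simp
  also have "\<dots> = (cls ?r \<otimes>\<^bsub>PM\<^esub> cls q) \<otimes>\<^bsub>PM\<^esub> (cls q \<otimes>\<^bsub>PM\<^esub> cls ?r)"
    by (simp add: m_assoc)
  also have "\<dots> = (cls q \<otimes>\<^bsub>PM\<^esub> cls ?r) \<otimes>\<^bsub>PM\<^esub> (cls ?r \<otimes>\<^bsub>PM\<^esub> cls q)"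
    using cls_range_idempotents_commute[of ?r q] by simp
  also have "\<dots> = cls q \<otimes>\<^bsub>PM\<^esub> (cls ?r \<otimes>\<^bsub>PM\<^esub> cls ?r) \<otimes>\<^bsub>PM\<^esub> cls q"
    by (simp add: m_assoc)
  also have "\<dots> = cls q" unfolding rr by (simp add: cls_word_inv)
  finally show ?thesis using qq by simp
qed

lemma inverse_monoid_PM: "inverse_monoid PM"
proof (rule monoid.inverse_monoidI[OF monoid_PM])
  fix x assume "x \<in> carrier PM"
  then obtain w where w: "w \<in> words A" "x = cls w" by (rule PM_cases)
  then show "\<exists>y\<in>carrier PM. x \<otimes>\<^bsub>PM\<^esub> y \<otimes>\<^bsub>PM\<^esub> x = x \<and> y \<otimes>\<^bsub>PM\<^esub> x \<otimes>\<^bsub>PM\<^esub> y = y"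
    using cls_word_inv[of w] cls_word_inv[of "word_inv w"]
    by (intro bexI[of _ "cls (word_inv w)"]) auto
next
  fix e f assume "e \<in> idempotents PM" "f \<in> idempotents PM"
  then obtain u v where u: "u \<in> words A" "e = cls u" "cls (u @ u) = cls u"
    and v: "v \<in> words A" "f = cls v" "cls (v @ v) = cls v"
    unfolding idempotents_def by (auto elim!: PM_cases simp: mult_PM)
  show "e \<otimes>\<^bsub>PM\<^esub> f = f \<otimes>\<^bsub>PM\<^esub> e"
    using cls_range_idempotents_commute[OF u(1) v(1)]
      idempotent_PM[OF u(1,3)] idempotent_PM[OF v(1,3)] u(2) v(2) by metis
qed

sublocale PM: inverse_monoid PM
  by (rule inverse_monoid_PM)

lemma ginv_PM: "w \<in> words A \<Longrightarrow> ginv PM (cls w) = cls (word_inv w)"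
  using cls_word_inv[of w] cls_word_inv[of "word_inv w"] by (intro PM.ginv_eqI) auto

end

section \<open>The monoids \<open>S\<^sub>k\<close>\<close>

declare One_nat_def [simp del] pow_nat [simp del]

text \<open>The letters \<open>a\<close>, \<open>b\<close>, \<open>c\<close> of the presentation are \<open>0\<close>, \<open>1\<close>, \<open>2\<close>.\<close>

definition relators :: "nat \<Rightarrow> nat word rel" where
  "relators k =
    {(replicate k (2, False), []),
     ([(2, True)], replicate (k - 1) (2, False)),
     ([(0, False), (2, False)], [(2, False), (0, False)]),
     ([(0, True), (2, False)], [(2, False), (0, True)]),
     ([(1, False), (2, False)], [(1, False)]),
     ([(2, False), (1, False)], [(1, False)]),
     ([(1, False), (1, False)], [(1, False)]),
     ([(1, True)], [(1, False)])}"

section \<open>Invariants of the walk described by a word\<close>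

definition letter_exp :: "nat \<Rightarrow> nat \<times> bool \<Rightarrow> int" where
  "letter_exp l x = (if fst x = l then if snd x then -1 else 1 else 0)"

text \<open>The endpoint of the walk for \<open>l = 0\<close>, the count of \<open>c\<close> for
  \<open>l = 2\<close>.\<close>

definition expo :: "nat \<Rightarrow> nat word \<Rightarrow> int" where
  "expo l w = (\<Sum>x\<leftarrow>w. letter_exp l x)"

text \<open>The vertex set of the Munn tree of the walk. The word is read from the front, so the
  first step translates everything that follows.\<close>

primrec visited :: "nat word \<Rightarrow> int set" where
  "visited [] = {0}"
| "visited (x # w) = insert 0 ((+) (letter_exp 0 x) ` visited w)"

primrec marks :: "nat word \<Rightarrow> int set" where
  "marks [] = {}"
| "marks (x # w) = (if fst x = 1 then {0} else {}) \<union> (+) (letter_exp 0 x) ` marks w"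

lemma expo_simps [simp]:
  "expo l [] = 0" "expo l (x # w) = letter_exp l x + expo l w"
  "expo l (u @ v) = expo l u + expo l v"
  by (simp_all add: expo_def)

lemma expo_replicate [simp]: "expo l (replicate n x) = int n * letter_exp l x"
  by (induction n) (auto simp: algebra_simps)

lemma expo_word_inv [simp]: "expo l (word_inv w) = - expo l w"
  by (induction w) (auto simp: letter_exp_def)

lemma zero_in_visited: "0 \<in> visited w"
  by (cases w) auto

lemma finite_visited: "finite (visited w)"
  by (induction w) auto

lemma visited_append [simp]: "visited (u @ v) = visited u \<union> (+) (expo 0 u) ` visited v"
  by (induction u) (auto simp: zero_in_visited image_Un image_image add.assoc)

lemma marks_append [simp]: "marks (u @ v) = marks u \<union> (+) (expo 0 u) ` marks v"
  by (induction u) (auto simp: image_Un image_image add.assoc)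

lemma expo_in_visited: "expo 0 w \<in> visited w"
  by (induction w) auto

text \<open>The inverse walk retraces the same points backwards, with the old endpoint as its
  origin.\<close>

lemma visited_word_inv: "visited (word_inv w) = (+) (- expo 0 w) ` visited w"
proof (induction w)
  case (Cons x w)
  have "- expo 0 w \<in> (+) (- expo 0 w) ` visited w"
    using zero_in_visited by force
  then show ?case
    using Cons by (auto simp: image_image letter_exp_def)
qed simp

lemma marks_word_inv: "marks (word_inv w) = (+) (- expo 0 w) ` marks w"
  by (induction w) (auto simp: image_image letter_exp_def)

lemma visited_replicate_2 [simp]: "fst x = 2 \<Longrightarrow> visited (replicate n x) = {0}"
  by (induction n) (auto simp: letter_exp_def)

lemma marks_replicate [simp]: "fst x \<noteq> 1 \<Longrightarrow> marks (replicate n x) = {}"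
  by (induction n) auto

lemma marks_cases:
  assumes "p \<in> marks w"
  obtains u x v where "w = u @ x # v" "fst x = 1" "expo 0 u = p"
proof -
  have "\<exists>u x v. w = u @ x # v \<and> fst x = 1 \<and> expo 0 u = p"
    using assms
  proof (induction w arbitrary: p)
    case (Cons y w)
    show ?case
    proof (cases "fst y = 1 \<and> p = 0")
      case True
      then show ?thesis by (intro exI[of _ "[]"]) auto
    next
      case False
      with Cons.prems obtain q where q: "q \<in> marks w" "p = letter_exp 0 y + q"
        by (auto split: if_splits)
      from Cons.IH[OF q(1)] obtain u x v where "w = u @ x # v" "fst x = 1" "expo 0 u = q" by blast
      with q show ?thesis by (intro exI[of _ "y # u"]) auto
    qed
  qed simp
  with that show ?thesis by blast
qed

text \<open>The count is compared only for words without marks, because \<open>b\<close> absorbs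
  \<open>c\<close>. This condition survives products: a concatenation has no marks only if neither
  factor has any.\<close>

lemma pres_cong_invariants:
  assumes k: "k \<ge> 1" and cong: "(u, v) \<in> pres_cong A (relators k)"
  shows "expo 0 u = expo 0 v \<and> visited u = visited v \<and> marks u = marks v \<and>
    (marks u = {} \<longrightarrow> int k dvd expo 2 u - expo 2 v)"
  using cong
proof (induction rule: pres_cong.induct)
  case (rel u v)
  then show ?case
    \<comment> \<open>The counts of \<open>c^-1\<close> and \<open>c^(k-1)\<close> differ by exactly
      \<open>k\<close>; \<open>k \<ge> 1\<close> keeps the subtraction of naturals from being
      truncated.\<close>
    using k unfolding relators_def by (auto simp: letter_exp_def of_nat_diff)
next
  case (regular w)
  then show ?case by (auto simp: visited_word_inv marks_word_inv image_image)
next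
  case (idem_comm u v)
  then show ?case by (auto simp: visited_word_inv marks_word_inv image_image image_Un)
next
  case (sym u v)
  then show ?case by (auto simp: dvd_diff_commute)
next
  case (trans u v w)
  then show ?case using dvd_add[of "int k" "expo 2 u - expo 2 v" "expo 2 v - expo 2 w"] by auto
next
  case (mult u v x y)
  then show ?case
    using dvd_add[of "int k" "expo 2 u - expo 2 v" "expo 2 x - expo 2 y"]
    by (auto simp: algebra_simps)
qed simp_all

section \<open>The monoid for a fixed \<open>k\<close>, with its generators and their powers\<close>

locale marked_line =
  fixes k :: nat
  assumes k_ge_2: "k \<ge> 2"
begin

sublocale presentation "{0, 1, 2}" "relators k"
  by unfold_locales (auto simp: relators_def)

abbreviation W :: "nat word set" where "W \<equiv> words {0, 1, 2}"

lemma cls_relator: "(u, v) \<in> relators k \<Longrightarrow> cls u = cls v"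
  by (intro cls_eqI pres_cong.rel)

lemma cls_invariants:
  assumes "cls u = cls v" "u \<in> W" "v \<in> W"
  shows "expo 0 u = expo 0 v" "visited u = visited v" "marks u = marks v"
    "marks u = {} \<Longrightarrow> int k dvd expo 2 u - expo 2 v"
  using pres_cong_invariants[of k u v "{0, 1, 2}"] assms cls_eq_iff k_ge_2 by auto

definition a where "a = cls [(0, False)]"
definition a' where "a' = cls [(0, True)]"
definition b where "b = cls [(1, False)]"
definition c where "c = cls [(2, False)]"

lemma gens_closed [simp]: "a \<in> carrier PM" "a' \<in> carrier PM" "b \<in> carrier PM" "c \<in> carrier PM"
  by (simp_all add: a_def a'_def b_def c_def)

lemma gens_comm:
  "a \<otimes>\<^bsub>PM\<^esub> c = c \<otimes>\<^bsub>PM\<^esub> a" "a' \<otimes>\<^bsub>PM\<^esub> c = c \<otimes>\<^bsub>PM\<^esub> a'"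
  "b \<otimes>\<^bsub>PM\<^esub> c = b" "c \<otimes>\<^bsub>PM\<^esub> b = b" "b \<otimes>\<^bsub>PM\<^esub> b = b"
  unfolding a_def a'_def b_def c_def
  by (simp add: mult_PM, rule cls_relator, simp add: relators_def)+

lemma cls_replicate: "fst x \<in> {0, 1, 2} \<Longrightarrow> cls (replicate n x) = cls [x] [^]\<^bsub>PM\<^esub> n"
proof (induction n)
  case (Suc n)
  have "cls (replicate (Suc n) x) = cls (replicate n x) \<otimes>\<^bsub>PM\<^esub> cls [x]"
    using Suc.prems by (simp add: mult_PM replicate_append_same)
  then show ?case using Suc by simp
qed (simp add: one_PM)

lemma c_pow_k: "c [^]\<^bsub>PM\<^esub> k = \<one>\<^bsub>PM\<^esub>"
proof -
  have "cls (replicate k (2, False)) = cls []"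
    by (rule cls_relator) (simp add: relators_def)
  then show ?thesis by (simp add: c_def cls_replicate one_PM)
qed

lemma c_pow_mod: "c [^]\<^bsub>PM\<^esub> (m mod k) = c [^]\<^bsub>PM\<^esub> m"
proof -
  have "c [^]\<^bsub>PM\<^esub> m = c [^]\<^bsub>PM\<^esub> (k * (m div k) + m mod k)" by simp
  also have "\<dots> = (c [^]\<^bsub>PM\<^esub> k) [^]\<^bsub>PM\<^esub> (m div k) \<otimes>\<^bsub>PM\<^esub> c [^]\<^bsub>PM\<^esub> (m mod k)"
    by (simp only: PM.nat_pow_mult[symmetric] PM.nat_pow_pow gens_closed)
  finally show ?thesis by (simp add: c_pow_k)
qed

lemma aa'_idempotent: "a \<otimes>\<^bsub>PM\<^esub> a' \<in> idempotents PM" "a' \<otimes>\<^bsub>PM\<^esub> a \<in> idempotents PM"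
  using cls_word_inv[of "[(0, False)]"] cls_word_inv[of "[(0, True)]"]
  by (simp_all add: idempotents_def a_def[symmetric] a'_def[symmetric] PM.m_assoc[symmetric])

lemma mult_pow_comm: "x \<in> carrier PM \<Longrightarrow> x \<otimes>\<^bsub>PM\<^esub> x [^]\<^bsub>PM\<^esub> (n::nat) = x [^]\<^bsub>PM\<^esub> n \<otimes>\<^bsub>PM\<^esub> x"
  by (metis PM.nat_pow_Suc PM.nat_pow_Suc2)

text \<open>As \<open>a\<close> is not a unit, \<open>a'\<close> stands in for its inverse at
  negative exponents. Exponents add only up to the natural order.\<close>

definition apow :: "int \<Rightarrow> nat word set" where
  "apow p = (if p \<ge> 0 then a [^]\<^bsub>PM\<^esub> nat p else a' [^]\<^bsub>PM\<^esub> nat (- p))"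

text \<open>Since \<open>c^k = 1\<close>, the residue modulo \<open>k\<close> can serve as the
  exponent, also for negative \<open>i\<close>. Here exponents add exactly.\<close>

definition cpow :: "int \<Rightarrow> nat word set" where
  "cpow i = c [^]\<^bsub>PM\<^esub> nat (i mod int k)"

lemma apow_closed [simp]: "apow p \<in> carrier PM"
  by (simp add: apow_def)

lemma cpow_closed [simp]: "cpow i \<in> carrier PM"
  by (simp add: cpow_def)

lemma cpow_of_nat: "cpow (int m) = c [^]\<^bsub>PM\<^esub> m"
  by (simp add: cpow_def nat_mod_distrib c_pow_mod)

lemma cpow_cong: "int k dvd i - j \<Longrightarrow> cpow i = cpow j"
  by (metis cpow_def mod_eq_dvd_iff)

lemma cpow_0: "cpow 0 = \<one>\<^bsub>PM\<^esub>"
  by (simp add: cpow_def)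

lemma cpow_add: "cpow i \<otimes>\<^bsub>PM\<^esub> cpow j = cpow (i + j)"
proof -
  have k: "int k > 0" using k_ge_2 by simp
  have "cpow i \<otimes>\<^bsub>PM\<^esub> cpow j = c [^]\<^bsub>PM\<^esub> (nat (i mod int k) + nat (j mod int k))"
    by (simp add: cpow_def PM.nat_pow_mult)
  also have "\<dots> = cpow (i mod int k + j mod int k)"
    using k by (simp add: cpow_of_nat[symmetric])
  also have "\<dots> = cpow (i + j)"
    by (simp add: cpow_def mod_simps)
  finally show ?thesis .
qed

lemma cpow_apow_comm: "cpow i \<otimes>\<^bsub>PM\<^esub> apow p = apow p \<otimes>\<^bsub>PM\<^esub> cpow i"
proof -
  have "c [^]\<^bsub>PM\<^esub> m \<otimes>\<^bsub>PM\<^esub> x [^]\<^bsub>PM\<^esub> n = x [^]\<^bsub>PM\<^esub> n \<otimes>\<^bsub>PM\<^esub> c [^]\<^bsub>PM\<^esub> m"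
    if "x \<otimes>\<^bsub>PM\<^esub> c = c \<otimes>\<^bsub>PM\<^esub> x" "x \<in> carrier PM" for x and m n :: nat
    using that by (metis PM.group_commutes_pow PM.nat_pow_closed gens_closed(4))
  then show ?thesis by (simp add: cpow_def apow_def gens_comm)
qed

lemma b_cpow: "b \<otimes>\<^bsub>PM\<^esub> cpow i = b" "cpow i \<otimes>\<^bsub>PM\<^esub> b = b"
proof -
  have "b \<otimes>\<^bsub>PM\<^esub> c [^]\<^bsub>PM\<^esub> n = b" for n :: nat
    by (induction n) (simp_all add: PM.m_assoc[symmetric] gens_comm)
  then show "b \<otimes>\<^bsub>PM\<^esub> cpow i = b" by (simp add: cpow_def)
  have "c [^]\<^bsub>PM\<^esub> n \<otimes>\<^bsub>PM\<^esub> b = b" for n :: nat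
    by (induction n) (simp_all add: PM.m_assoc gens_comm)
  then show "cpow i \<otimes>\<^bsub>PM\<^esub> b = b" by (simp add: cpow_def)
qed

lemma b_idempotent: "b \<in> idempotents PM"
  by (simp add: idempotents_def gens_comm)

lemma cls_b: "fst x = 1 \<Longrightarrow> cls [x] = b"
proof -
  have "cls [(1, True)] = b"
    unfolding b_def by (rule cls_relator) (simp add: relators_def)
  moreover assume "fst x = 1"
  ultimately show ?thesis by (cases x; cases "snd x") (auto simp: b_def)
qed

lemma cls_c: "fst x = 2 \<Longrightarrow> cls [x] = cpow (letter_exp 2 x)"
proof -
  assume x: "fst x = 2"
  have "cls [(2, True)] = cls (replicate (k - 1) (2, False))"
    by (rule cls_relator) (simp add: relators_def)
  also have "\<dots> = c [^]\<^bsub>PM\<^esub> (k - 1)" by (simp add: c_def cls_replicate)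
  also have "\<dots> = cpow (int (k - 1))" by (simp add: cpow_of_nat)
  also have "\<dots> = cpow (- 1)" using k_ge_2 by (intro cpow_cong) (simp add: of_nat_diff)
  finally have "cls [(2, True)] = cpow (- 1)" .
  moreover have "cls [(2, False)] = cpow 1"
    using cpow_of_nat[of "Suc 0"] by (simp add: c_def)
  ultimately show ?thesis
    using x by (cases x; cases "snd x") (auto simp: letter_exp_def)
qed

section \<open>Upper bounds \<open>a^p c^i\<close> for all words\<close>

lemma a_apow_le: "nat_le PM (a \<otimes>\<^bsub>PM\<^esub> apow p) (apow (1 + p))"
proof (cases "p \<ge> 0")
  case True
  then have "a \<otimes>\<^bsub>PM\<^esub> apow p = apow (1 + p)"
    by (simp add: apow_def nat_add_distrib mult_pow_comm)
  then show ?thesis by (simp add: PM.nat_le_refl)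
next
  case False
  \<comment> \<open>For negative \<open>p\<close> one \<open>a'\<close> splits off, and
    \<open>a\<close> cancels it up to the idempotent \<open>a a'\<close>.\<close>
  then have "nat (- p) = Suc (nat (- (1 + p)))" by simp
  then have "apow p = a' \<otimes>\<^bsub>PM\<^esub> apow (1 + p)"
    using False by (auto simp: apow_def mult_pow_comm)
  then have "a \<otimes>\<^bsub>PM\<^esub> apow p = (a \<otimes>\<^bsub>PM\<^esub> a') \<otimes>\<^bsub>PM\<^esub> apow (1 + p)"
    by (simp add: PM.m_assoc)
  then show ?thesis using aa'_idempotent unfolding nat_le_def by blast
qed

lemma a'_apow_le: "nat_le PM (a' \<otimes>\<^bsub>PM\<^esub> apow p) (apow (- 1 + p))"
proof (cases "p \<le> 0")
  case True
  then have "nat (1 - p) = Suc (nat (- p))" by simp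
  then have "a' \<otimes>\<^bsub>PM\<^esub> apow p = apow (- 1 + p)"
    using True by (auto simp: apow_def mult_pow_comm)
  then show ?thesis by (simp add: PM.nat_le_refl)
next
  case False
  then have "nat p = Suc (nat (- 1 + p))" by simp
  then have "apow p = a \<otimes>\<^bsub>PM\<^esub> apow (- 1 + p)"
    using False by (auto simp: apow_def mult_pow_comm)
  then have "a' \<otimes>\<^bsub>PM\<^esub> apow p = (a' \<otimes>\<^bsub>PM\<^esub> a) \<otimes>\<^bsub>PM\<^esub> apow (- 1 + p)"
    by (simp add: PM.m_assoc)
  then show ?thesis using aa'_idempotent unfolding nat_le_def by blast
qed

lemma letter_apow_le:
  assumes "fst x \<in> {0, 1, 2}"
  shows "nat_le PM (cls [x] \<otimes>\<^bsub>PM\<^esub> apow p) (apow (letter_exp 0 x + p) \<otimes>\<^bsub>PM\<^esub> cpow (letter_exp 2 x))"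
proof -
  consider "x = (0, False)" | "x = (0, True)" | "fst x = 1" | "fst x = 2"
    using assms by (cases x; cases "snd x") auto
  then show ?thesis
  proof cases
    case 1
    then show ?thesis using a_apow_le[of p] by (simp add: letter_exp_def cpow_0 a_def)
  next
    case 2
    then show ?thesis using a'_apow_le[of p] by (simp add: letter_exp_def cpow_0 a'_def)
  next
    case 3
    then show ?thesis
      using b_idempotent unfolding nat_le_def by (auto simp: letter_exp_def cpow_0 cls_b)
  next
    case 4
    then show ?thesis by (simp add: cls_c cpow_apow_comm letter_exp_def PM.nat_le_refl)
  qed
qed

text \<open>The order is compatible with products, so letters can be prepended one at a time: each
  \<open>b\<close> is raised to 1, each \<open>c\<close> moves past the power of \<open>a\<close>,
  and each \<open>a\<close> or \<open>a'\<close> shifts the exponent.\<close>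

lemma cls_le_apow_cpow:
  "w \<in> W \<Longrightarrow> nat_le PM (cls w) (apow (expo 0 w) \<otimes>\<^bsub>PM\<^esub> cpow (expo 2 w))"
proof (induction w)
  case Nil
  then show ?case by (simp add: apow_def cpow_0 one_PM[symmetric] PM.nat_le_refl)
next
  case (Cons x w)
  let ?p = "expo 0 w" and ?i = "expo 2 w"
  have x: "fst x \<in> {0, 1, 2}" "w \<in> W" using Cons.prems by auto
  have cx: "cls [x] \<in> carrier PM" using x by simp
  have "cls (x # w) = cls [x] \<otimes>\<^bsub>PM\<^esub> cls w"
    using Cons.prems by (simp add: mult_PM)
  moreover have "nat_le PM (cls [x] \<otimes>\<^bsub>PM\<^esub> cls w) (cls [x] \<otimes>\<^bsub>PM\<^esub> (apow ?p \<otimes>\<^bsub>PM\<^esub> cpow ?i))"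
    using cx Cons.IH[OF x(2)] by (intro PM.nat_le_mult PM.nat_le_refl) auto
  moreover have "nat_le PM ((cls [x] \<otimes>\<^bsub>PM\<^esub> apow ?p) \<otimes>\<^bsub>PM\<^esub> cpow ?i)
     ((apow (letter_exp 0 x + ?p) \<otimes>\<^bsub>PM\<^esub> cpow (letter_exp 2 x)) \<otimes>\<^bsub>PM\<^esub> cpow ?i)"
    using x by (intro PM.nat_le_mult PM.nat_le_refl letter_apow_le) auto
  ultimately show ?case
    using cx PM.nat_le_trans by (simp add: PM.m_assoc cpow_add)
qed

text \<open>The upper bound is 1 here, and the elements below 1 are exactly the idempotents.\<close>

lemma idempotent_if_expo_zero:
  assumes "w \<in> W" "expo 0 w = 0" "int k dvd expo 2 w"
  shows "cls w \<in> idempotents PM"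
  using cls_le_apow_cpow[OF assms(1)] assms(2) cpow_cong[of "expo 2 w" 0] assms(3)
  by (simp add: apow_def cpow_0 PM.nat_le_one_iff)

section \<open>The maximal idempotents \<open>a^n b a^-n\<close> below \<open>c\<close>\<close>

definition peak :: "nat \<Rightarrow> nat word" where
  "peak n = replicate n (0, False) @ [(1, False)] @ replicate n (0, True)"

lemma peak_words [simp]: "peak n \<in> W"
  by (simp add: peak_def)

lemma marks_peak: "marks (peak n) = {int n}"
  by (simp add: peak_def letter_exp_def)

lemma cls_peak: "cls (peak n) = apow (int n) \<otimes>\<^bsub>PM\<^esub> b \<otimes>\<^bsub>PM\<^esub> apow (- int n)"
  by (simp add: peak_def apow_def a_def a'_def b_def cls_replicate[symmetric] mult_PM)

lemma peak_idempotent: "cls (peak n) \<in> idempotents PM"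
  by (rule idempotent_if_expo_zero) (simp_all add: peak_def letter_exp_def)

text \<open>The power of \<open>c\<close> slides through \<open>a^-n\<close> to \<open>b\<close> and
  is absorbed there.\<close>

lemma peak_cpow: "cls (peak n) \<otimes>\<^bsub>PM\<^esub> cpow i = cls (peak n)"
proof -
  have "cls (peak n) \<otimes>\<^bsub>PM\<^esub> cpow i = apow (int n) \<otimes>\<^bsub>PM\<^esub> (b \<otimes>\<^bsub>PM\<^esub> cpow i) \<otimes>\<^bsub>PM\<^esub> apow (- int n)"
    by (simp add: cls_peak PM.m_assoc cpow_apow_comm)
  then show ?thesis by (simp add: b_cpow cls_peak)
qed

lemma peak_le_c: "nat_le PM (cls (peak n)) c"
proof -
  have "cls (peak n) = cls (peak n) \<otimes>\<^bsub>PM\<^esub> c"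
    using peak_cpow[of n 1] cpow_of_nat[of "Suc 0"] by simp
  then show ?thesis using peak_idempotent unfolding nat_le_def by blast
qed

text \<open>Cut the word at a letter \<open>b\<close> read at position \<open>n\<close>, and bound
  the two outer pieces by \<open>a^n c^i\<close> and \<open>a^-n c^j\<close>. Both powers of
  \<open>c\<close> are absorbed, which leaves the peak.\<close>

lemma le_peak_if_mark:
  assumes v: "v \<in> W" and p: "int n \<in> marks v" and e: "expo 0 v = 0"
  shows "nat_le PM (cls v) (cls (peak n))"
proof -
  obtain u x w where v_eq: "v = u @ x # w" and x: "fst x = 1" and u: "expo 0 u = int n"
    using p by (rule marks_cases)
  have W: "u \<in> W" "w \<in> W" "[x] \<in> W" using v v_eq by auto
  have w: "expo 0 w = - int n" using e v_eq u x by (simp add: letter_exp_def)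
  have "cls v = cls u \<otimes>\<^bsub>PM\<^esub> b \<otimes>\<^bsub>PM\<^esub> cls w"
    using W by (simp add: v_eq cls_b[OF x, symmetric] mult_PM)
  moreover have "nat_le PM (cls u \<otimes>\<^bsub>PM\<^esub> b \<otimes>\<^bsub>PM\<^esub> cls w)
    ((apow (int n) \<otimes>\<^bsub>PM\<^esub> cpow (expo 2 u)) \<otimes>\<^bsub>PM\<^esub> b \<otimes>\<^bsub>PM\<^esub> (apow (- int n) \<otimes>\<^bsub>PM\<^esub> cpow (expo 2 w)))"
    using cls_le_apow_cpow[OF W(1)] cls_le_apow_cpow[OF W(2)]
    by (intro PM.nat_le_mult PM.nat_le_refl) (simp_all add: u w)
  moreover have "(apow (int n) \<otimes>\<^bsub>PM\<^esub> cpow (expo 2 u)) \<otimes>\<^bsub>PM\<^esub> b \<otimes>\<^bsub>PM\<^esub> (apow (- int n) \<otimes>\<^bsub>PM\<^esub> cpow (expo 2 w))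
    = cls (peak n) \<otimes>\<^bsub>PM\<^esub> cpow (expo 2 w)"
    by (simp add: cls_peak PM.m_assoc b_cpow)
  ultimately show ?thesis by (simp add: peak_cpow)
qed

text \<open>Comparing the invariants of \<open>v v\<close> and \<open>v\<close> shows that the
  endpoint equals its double, hence vanishes, and likewise for the count modulo \<open>k\<close>
  when there are no marks.\<close>

lemma idempotent_words:
  assumes "f \<in> idempotents PM"
  obtains v where "v \<in> W" "f = cls v" "expo 0 v = 0" "marks v = {} \<Longrightarrow> int k dvd expo 2 v"
proof -
  obtain v where v: "v \<in> W" "f = cls v"
    using assms PM.idempotent_closed by (blast elim: PM_cases)
  then have "cls (v @ v) = cls v"
    using PM.idempotent_idem[OF assms] by (simp add: mult_PM)
  from cls_invariants[OF this] v that show ?thesis by auto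
qed

lemma peak_max_idem_below: "cls (peak n) \<in> max_idem_below PM c"
proof -
  have "f = cls (peak n)"
    if f: "f \<in> idempotents PM" and fc: "nat_le PM f c" and ef: "nat_le PM (cls (peak n)) f" for f
  proof -
    obtain v where v: "v \<in> W" "f = cls v" "expo 0 v = 0" "marks v = {} \<Longrightarrow> int k dvd expo 2 v"
      using f by (rule idempotent_words) blast
    obtain g where "g \<in> idempotents PM" and fg: "f = g \<otimes>\<^bsub>PM\<^esub> c"
      using fc unfolding nat_le_def by blast
    then obtain u where u: "u \<in> W" "g = cls u" "expo 0 u = 0" "marks u = {} \<Longrightarrow> int k dvd expo 2 u"
      by (blast elim: idempotent_words)
    have "cls v = cls (u @ [(2, False)])"
      using fg u v by (simp add: c_def mult_PM)
    note vu = cls_invariants[OF this v(1)]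
    \<comment> \<open>Without marks the count of \<open>f = g c\<close> would be congruent modulo
      \<open>k\<close> to 0, as \<open>f\<close> is idempotent, and to 1, as \<open>g\<close>
      is.\<close>
    have "marks v \<noteq> {}"
    proof
      assume m: "marks v = {}"
      then have "marks u = {}" using vu u by auto
      then have "int k dvd expo 2 u" "int k dvd expo 2 v" "int k dvd expo 2 v - (expo 2 u + 1)"
        using u v vu(4) m by (auto simp: letter_exp_def)
      then have "int k dvd expo 2 v - expo 2 u - (expo 2 v - (expo 2 u + 1))"
        by (intro dvd_diff[OF dvd_diff])
      then show False using k_ge_2 by simp
    qed
    obtain h where "h \<in> idempotents PM" and eh: "cls (peak n) = h \<otimes>\<^bsub>PM\<^esub> f"
      using ef unfolding nat_le_def by blast
    then obtain z where z: "z \<in> W" "h = cls z" "expo 0 z = 0"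
      by (blast elim: idempotent_words)
    \<comment> \<open>The walk \<open>z\<close> ends at 0, so the marks of \<open>v\<close> appear
      untranslated among those of the peak, whose only mark is \<open>n\<close>.\<close>
    have "cls (peak n) = cls (z @ v)"
      using eh z v by (simp add: mult_PM)
    from cls_invariants(3)[OF this] z v have "marks v \<subseteq> {int n}"
      by (auto simp: marks_peak)
    with \<open>marks v \<noteq> {}\<close> have "int n \<in> marks v" by auto
    then have "nat_le PM f (cls (peak n))" using le_peak_if_mark v by simp
    then show ?thesis using ef v by (intro PM.nat_le_antisym) auto
  qed
  then show ?thesis
    using peak_idempotent peak_le_c unfolding max_idem_below_def lower_set_def by auto
qed

lemma infinite_max_idem_below: "infinite (max_idem_below PM c)"
proof -
  have "inj (\<lambda>n. cls (peak n))"
  proof (rule injI)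
    fix m n assume "cls (peak m) = cls (peak n)"
    from cls_invariants(3)[OF this] show "m = n" by (simp add: marks_peak)
  qed
  then have "infinite (range (\<lambda>n. cls (peak n)))"
    using finite_imageD infinite_UNIV_nat by blast
  then show ?thesis using peak_max_idem_below by (meson finite_subset image_subsetI)
qed

section \<open>Finiteness of the R-classes\<close>

lemma green_R_visited:
  assumes R: "(cls u, cls v) \<in> green_R PM" and u: "u \<in> W" and v: "v \<in> W"
  shows "visited u = visited v"
proof -
  \<comment> \<open>Multiplying on the right prolongs the walk and so can only add visited
    points.\<close>
  have sub: "visited u \<subseteq> visited v"
    if z: "z \<in> carrier PM" and vz: "cls v = cls u \<otimes>\<^bsub>PM\<^esub> z" and u: "u \<in> W" and v: "v \<in> W" for u v z
  proof -
    obtain y where y: "y \<in> W" "z = cls y" using z by (rule PM_cases)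
    then have "cls v = cls (u @ y)" using vz u by (simp add: mult_PM)
    from cls_invariants(2)[OF this] u v y show ?thesis by auto
  qed
  show ?thesis using PM.green_R_factor[OF R] sub u v by blast
qed

text \<open>The word \<open>u^-1 v\<close> ends at 0 with count divisible by \<open>k\<close>, so
  its class is idempotent. Multiplying \<open>u\<close> by it gives \<open>v\<close>, since
  \<open>u u^-1\<close> fixes every right multiple of \<open>u\<close>; but an idempotent that keeps
  \<open>u\<close> in its R-class fixes \<open>u\<close>.\<close>

lemma green_R_eqI:
  assumes R: "(cls u, cls v) \<in> green_R PM" and u: "u \<in> W" and v: "v \<in> W"
    and e0: "expo 0 u = expo 0 v" and e2: "expo 2 u mod int k = expo 2 v mod int k"
  shows "cls u = cls v"
proof -
  let ?y = "word_inv u @ v"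
  note [simp] = u v
  have idem: "cls ?y \<in> idempotents PM"
    by (rule idempotent_if_expo_zero)
      (use e0 e2 in \<open>simp_all add: mod_eq_dvd_iff\<close>, metis dvd_minus_iff minus_diff_eq)
  obtain z z' where z: "z \<in> carrier PM" "cls v = cls u \<otimes>\<^bsub>PM\<^esub> z"
    and z': "z' \<in> carrier PM" "cls u = cls v \<otimes>\<^bsub>PM\<^esub> z'"
    using PM.green_R_factor[OF R] by blast
  have "cls u \<otimes>\<^bsub>PM\<^esub> cls ?y = cls u \<otimes>\<^bsub>PM\<^esub> cls (word_inv u) \<otimes>\<^bsub>PM\<^esub> cls v"
    by (simp add: mult_PM)
  also have "\<dots> = (cls u \<otimes>\<^bsub>PM\<^esub> cls (word_inv u) \<otimes>\<^bsub>PM\<^esub> cls u) \<otimes>\<^bsub>PM\<^esub> z"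
    unfolding z(2) using z(1) by (simp add: PM.m_assoc)
  also have "\<dots> = cls v" using z by (simp add: cls_word_inv)
  finally have uy: "cls u \<otimes>\<^bsub>PM\<^esub> cls ?y = cls v" .
  then have "cls u \<otimes>\<^bsub>PM\<^esub> cls ?y = cls u"
    using z' idem by (intro PM.R_related_mult_idempotent[of _ _ z']) simp_all
  then show ?thesis using uy by simp
qed

lemma finite_R_class:
  assumes "C \<in> carrier PM // green_R PM"
  shows "finite C"
proof -
  obtain s where s: "s \<in> carrier PM" and C: "C = green_R PM `` {s}"
    using assms by (auto simp: quotient_def)
  obtain w where w: "w \<in> W" "s = cls w" using s by (rule PM_cases)
  \<comment> \<open>For marked elements the count modulo \<open>k\<close> depends on the chosen
    word. Any choice will do, since \<open>green_R_eqI\<close> applies to arbitrary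
    representatives.\<close>
  define rep where "rep t = (SOME v. v \<in> W \<and> t = cls v)" for t
  have rep: "rep t \<in> W \<and> t = cls (rep t)" if "t \<in> C" for t
  proof -
    have "t \<in> carrier PM" using that C PM.green_R_factor by blast
    then show ?thesis unfolding rep_def by (intro someI_ex[of "\<lambda>v. v \<in> W \<and> t = cls v"]) (blast elim: PM_cases)
  qed
  let ?f = "\<lambda>t. (expo 0 (rep t), expo 2 (rep t) mod int k)"
  have "inj_on ?f C"
  proof (rule inj_onI)
    fix t t' assume t: "t \<in> C" "t' \<in> C" "?f t = ?f t'"
    then have "(t, t') \<in> green_R PM" unfolding C green_R_def by auto
    then show "t = t'"
      using green_R_eqI[of "rep t" "rep t'"] rep[OF t(1)] rep[OF t(2)] t(3) by auto
  qed
  moreover have "?f ` C \<subseteq> visited w \<times> {0..<int k}"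
  proof
    fix x assume "x \<in> ?f ` C"
    then obtain t where t: "t \<in> C" "x = ?f t" by blast
    have "visited w = visited (rep t)"
      using green_R_visited[of w "rep t"] rep[OF t(1)] t(1) w C by auto
    then show "x \<in> visited w \<times> {0..<int k}"
      using expo_in_visited[of "rep t"] k_ge_2 t(2) by auto
  qed
  ultimately show ?thesis
    by (rule inj_on_finite) (simp add: finite_visited)
qed

section \<open>Generation, presentation and the group of units\<close>

lemma generated_by_three: "n_generated 3 PM"
proof -
  let ?X = "{a, b, c}"
  \<comment> \<open>The generating set must have exactly three elements; marks and endpoints
    separate them.\<close>
  have ab: "a \<noteq> b" using cls_invariants(3)[of "[(0, False)]" "[(1, False)]"] by (auto simp: a_def b_def)
  have cb: "c \<noteq> b" using cls_invariants(3)[of "[(2, False)]" "[(1, False)]"] by (auto simp: c_def b_def)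
  have ac: "a \<noteq> c"
    using cls_invariants(1)[of "[(0, False)]" "[(2, False)]"] by (auto simp: a_def c_def letter_exp_def)
  have letter: "cls [x] \<in> inv_submonoid_gen PM ?X" if "fst x \<in> {0, 1, 2}" for x
  proof -
    have gen: "cls [(l, False)] \<in> inv_submonoid_gen PM ?X" if "l \<in> {0, 1, 2}" for l
      using that by (intro inv_submonoid_gen.incl) (auto simp: a_def b_def c_def)
    obtain l s where x: "x = (l, s)" by (cases x)
    have "ginv PM (cls [(l, False)]) = cls [(l, True)]"
      using that x ginv_PM[of "[(l, False)]"] by simp
    then show ?thesis
      using gen[of l] inv_submonoid_gen.ginv[OF gen[of l]] that x by (cases s) auto
  qed
  have "cls w \<in> inv_submonoid_gen PM ?X" if "w \<in> W" for w
    using that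
  proof (induction w)
    case Nil
    then show ?case using inv_submonoid_gen.one[of PM ?X] by (simp add: one_PM)
  next
    case (Cons x w)
    then have "cls [x] \<otimes>\<^bsub>PM\<^esub> cls w \<in> inv_submonoid_gen PM ?X"
      by (intro inv_submonoid_gen.mult letter) auto
    then show ?case using Cons.prems by (simp add: mult_PM)
  qed
  moreover have "x \<in> carrier PM" if "x \<in> inv_submonoid_gen PM ?X" for x
    using that by induction (auto intro: PM.ginv_closed)
  ultimately have "inv_submonoid_gen PM ?X = carrier PM"
    by (auto elim!: PM_cases)
  then show ?thesis
    unfolding n_generated_def using ab ac cb by (intro exI[of _ ?X]) auto
qed

lemma finitely_presented_PM: "finitely_presented PM"
  unfolding finitely_presented_def
  using rel_words iso_refl by (intro exI[of _ "{0, 1, 2}"] exI[of _ "relators k"]) (auto simp: relators_def)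

lemma cpow_Units: "cpow i \<in> Units PM"
proof -
  have "cpow i \<otimes>\<^bsub>PM\<^esub> cpow (- i) = \<one>\<^bsub>PM\<^esub>" "cpow (- i) \<otimes>\<^bsub>PM\<^esub> cpow i = \<one>\<^bsub>PM\<^esub>"
    by (simp_all add: cpow_add cpow_0)
  then show ?thesis unfolding Units_def using cpow_closed by blast
qed

text \<open>The walk of a unit extends to one with the invariants of the empty word, so it never
  leaves 0. Hence the unit is \<open>e c^i\<close> with \<open>e\<close> idempotent; then
  \<open>e\<close> is itself a unit, and an idempotent unit is 1.\<close>

lemma Units_PM: "Units PM = (\<lambda>i. c [^]\<^bsub>PM\<^esub> i) ` {..<k}"
proof
  show "Units PM \<subseteq> (\<lambda>i. c [^]\<^bsub>PM\<^esub> i) ` {..<k}"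
  proof
    fix x assume x: "x \<in> Units PM"
    then obtain w where w: "w \<in> W" "x = cls w" by (blast elim: PM_cases)
    obtain u where u: "u \<in> W" "cls w \<otimes>\<^bsub>PM\<^esub> cls u = \<one>\<^bsub>PM\<^esub>"
      using x w unfolding Units_def by (auto elim!: PM_cases)
    then have "cls (w @ u) = cls []" using w by (simp add: mult_PM one_PM)
    from cls_invariants(2)[OF this] u w have "visited w \<subseteq> {0}" by auto
    then have "expo 0 w = 0" using expo_in_visited[of w] by auto
    then have "nat_le PM x (cpow (expo 2 w))"
      using cls_le_apow_cpow[OF w(1)] w(2) by (simp add: apow_def)
    then obtain e where e: "e \<in> idempotents PM" "x = e \<otimes>\<^bsub>PM\<^esub> cpow (expo 2 w)"
      unfolding nat_le_def by blast
    have ec: "e \<in> carrier PM" using e(1) by (rule PM.idempotent_closed)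
    have "x \<otimes>\<^bsub>PM\<^esub> cpow (- expo 2 w) = e"
      using e(2) ec by (simp add: PM.m_assoc cpow_add cpow_0)
    then have "e \<in> Units PM" using x cpow_Units PM.Units_m_closed by metis
    then have "e = \<one>\<^bsub>PM\<^esub>"
      using PM.idempotent_idem[OF e(1)] ec by (metis PM.Units_l_cancel PM.one_closed PM.r_one)
    then have "x = c [^]\<^bsub>PM\<^esub> nat (expo 2 w mod int k)" using e(2) by (simp add: cpow_def)
    moreover have "nat (expo 2 w mod int k) < k" using k_ge_2 by (simp add: nat_less_iff)
    ultimately show "x \<in> (\<lambda>i. c [^]\<^bsub>PM\<^esub> i) ` {..<k}" by blast
  qed
  show "(\<lambda>i. c [^]\<^bsub>PM\<^esub> i) ` {..<k} \<subseteq> Units PM"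
    using cpow_Units by (auto simp: cpow_of_nat[symmetric])
qed

text \<open>Powers of \<open>c\<close> carry no marks, so their counts modulo \<open>k\<close> tell
  them apart.\<close>

lemma card_Units_PM: "card (Units PM) = k"
proof -
  have "inj_on (\<lambda>i. c [^]\<^bsub>PM\<^esub> i) {..<k}"
  proof (rule inj_onI)
    fix i j assume ij: "i \<in> {..<k}" "j \<in> {..<k}" "c [^]\<^bsub>PM\<^esub> i = c [^]\<^bsub>PM\<^esub> j"
    then have "cls (replicate i (2, False)) = cls (replicate j (2, False))"
      by (simp add: c_def cls_replicate)
    from cls_invariants(4)[OF this] have "int k dvd int i - int j"
      by (simp add: letter_exp_def)
    then have "int i mod int k = int j mod int k" by (simp add: mod_eq_dvd_iff)
    then show "i = j" using ij by simp
  qed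
  then show ?thesis by (simp add: Units_PM card_image)
qed

end

section \<open>Nonisomorphism and the final family\<close>

lemma card_Units_iso:
  assumes "monoid S" "monoid T" and "S \<cong> T"
  shows "card (Units S) = card (Units T)"
proof -
  interpret S: monoid S by fact
  interpret T: monoid T by fact
  obtain h where h: "h \<in> iso S T" using assms(3) by (auto simp: is_iso_def)
  have hom: "h (x \<otimes>\<^bsub>S\<^esub> y) = h x \<otimes>\<^bsub>T\<^esub> h y" if "x \<in> carrier S" "y \<in> carrier S" for x y
    using h that by (auto simp: iso_def hom_def)
  have img: "h ` carrier S = carrier T" and inj: "inj_on h (carrier S)"
    using h by (auto simp: iso_def bij_betw_def)
  have closed: "h x \<in> carrier T" if "x \<in> carrier S" for x using img that by blast
  \<comment> \<open>Homomorphisms are only required to respect products. By surjectivity the image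
    of 1 is a right identity, hence equal to 1.\<close>
  have "y \<otimes>\<^bsub>T\<^esub> h \<one>\<^bsub>S\<^esub> = y" if "y \<in> carrier T" for y
    using that hom[of _ "\<one>\<^bsub>S\<^esub>"] unfolding img[symmetric] by auto
  from this[of "\<one>\<^bsub>T\<^esub>"] have one: "h \<one>\<^bsub>S\<^esub> = \<one>\<^bsub>T\<^esub>"
    using closed by simp
  have inv_iff: "h x \<otimes>\<^bsub>T\<^esub> h y = \<one>\<^bsub>T\<^esub> \<longleftrightarrow> x \<otimes>\<^bsub>S\<^esub> y = \<one>\<^bsub>S\<^esub>"
    if "x \<in> carrier S" "y \<in> carrier S" for x y
    using inj_on_eq_iff[OF inj, of "x \<otimes>\<^bsub>S\<^esub> y" "\<one>\<^bsub>S\<^esub>"] that by (simp add: hom one)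
  have "h ` Units S = Units T"
    unfolding Units_def img[symmetric] by (fastforce simp: inv_iff)
  moreover have "inj_on h (Units S)"
    using inj by (rule inj_on_subset) auto
  ultimately show ?thesis using card_image by metis
qed

theorem proposition4p2:
  shows "\<exists>\<S> :: nat word set monoid set.
    infinite \<S> \<and>
    pairwise (\<lambda>S T. \<not> S \<cong> T) \<S> \<and>
    (\<forall>S \<in> \<S>. inverse_monoid S \<and> finitely_presented S \<and> n_generated 3 S \<and>
       (\<forall>C \<in> carrier S // green_R S. finite C) \<and>
       (\<exists>s \<in> carrier S. infinite (max_idem_below S s)))"
proof -
  define M where "M k = pres_monoid {0, 1, 2} (relators k)" for k
  have line: "marked_line k" if "k \<ge> 2" for k using that by unfold_locales
  have M: "inverse_monoid (M k)" "finitely_presented (M k)" "n_generated 3 (M k)"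
    "\<forall>C \<in> carrier (M k) // green_R (M k). finite C"
    "\<exists>s \<in> carrier (M k). infinite (max_idem_below (M k) s)" "card (Units (M k)) = k"
    if "k \<ge> 2" for k
  proof -
    interpret marked_line k using line[OF that] .
    show "inverse_monoid (M k)" "finitely_presented (M k)" "n_generated 3 (M k)"
      "\<forall>C \<in> carrier (M k) // green_R (M k). finite C"
      "\<exists>s \<in> carrier (M k). infinite (max_idem_below (M k) s)" "card (Units (M k)) = k"
      unfolding M_def
      using inverse_monoid_PM finitely_presented_PM generated_by_three finite_R_class
        infinite_max_idem_below gens_closed(4) card_Units_PM by blast+
  qed
  have iso: "k = l" if "k \<ge> 2" "l \<ge> 2" "M k \<cong> M l" for k l
    using card_Units_iso[of "M k" "M l"] M(1,6) that inverse_monoid.axioms(1) by metis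
  \<comment> \<open>The number of units recovers \<open>k\<close>, so distinct \<open>k\<close> give
    distinct members of the family.\<close>
  have "inj_on M {2..}"
    using M(6) by (intro inj_onI) (metis atLeast_iff)
  then have "infinite (M ` {2..})"
    using infinite_Ici finite_imageD by blast
  moreover have "pairwise (\<lambda>S T. \<not> S \<cong> T) (M ` {2..})"
    using iso by (intro pairwiseI) auto
  ultimately show ?thesis using M(1-5) by (intro exI[of _ "M ` {2..}"]) auto
qed

end
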